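(* For every $p\in[0,1/2)$ and every $\epsilon>0$, two deterministic $p$-faulty agents can solve probabilistically disoriented linear search with parameter $p$ with competitive ratio $9+\epsilon$, independently of the underlying communication model (wireless or face-to-face). Moreover, the performance can be concentrated arbitrarily close to $9+\epsilon$.
   Context: Two agents start at the origin of the real line and move at speed at most $1$ independently of each other (each may also slow down or halt). A hidden target is at an unknown point $x\in\mathbb{R}$ and is detected when an agent walks over it; the origin is also distinguishable. Each agent is $p$-faulty: every attempt to change direction fails independently (and independently of the other agent) with probability $p$, in which case it keeps moving in the same direction, and the agent is not informed of the outcome. Initially agents start moving in chosen directions without fault. Agents detect when they meet; a meeting agent can serve as a distinguished point for the other, and an agent moving in some direction can pick up another agent it meets so that both continue in that direction with probability $1$. In the wireless model messages are exchanged instantaneously; in the face-to-face model only when co-located. Deterministic agents have no random oracle. If $E(x)$ is the expected time at which the last agent reaches target $x$, the competitive ratio is $\limsup_{|x|\to\infty}E(x)/|x|$. *)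

theory Defs
  imports "HOL-Probability.Probability"
begin

text \<open>
  Two agents on the real line, as an event-driven system.  Between two consecutive events the
  agents move linearly; at an event the agents concerned record what they perceive and choose
  their next action.  An execution depends on the protocol, the communication model, the target
  and the outcomes of the attempted turns.
\<close>

datatype agent = Agent1 | Agent2

fun other :: "agent \<Rightarrow> agent" where
  "other Agent1 = Agent2"
| "other Agent2 = Agent1"

datatype heading = Leftward | Rightward

fun opposite :: "heading \<Rightarrow> heading" where
  "opposite Leftward = Rightward"
| "opposite Rightward = Leftward"

fun sign :: "heading \<Rightarrow> real" where
  "sign Leftward = -1"
| "sign Rightward = 1"

datatype comm_model = Wireless | Face_To_Face


subsection \<open>Protocols\<close>

text \<open>
  A percept contains neither the agent's position nor its heading, nor the outcome of an attempted
  turn: these are known to an agent only as far as it can infer them.  Communication is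
  full-information: a message is everything the other agent has perceived so far.
\<close>

datatype percept =
  Percept (clock: real) (at_origin: bool) (at_target: bool) (meeting: bool)
    (message: "percept list option")

datatype manoeuvre = Continue | Turn | Pick_Up

record action =
  manoeuvre :: manoeuvre
  new_speed :: real
  timeout :: real

text \<open>
  An agent is deterministic: its action is a function of its own percepts, listed in chronological
  order.  The agents may play different roles.
\<close>

record protocol =
  start_heading :: "agent \<Rightarrow> heading"
  decide :: "agent \<Rightarrow> percept list \<Rightarrow> action"

definition admissible :: "protocol \<Rightarrow> bool" where
  "admissible P \<longleftrightarrow> (\<forall>i h. 0 \<le> new_speed (decide P i h) \<and> new_speed (decide P i h) \<le> 1
     \<and> 0 < timeout (decide P i h))"


subsection \<open>Executions\<close>

record agent_state =
  pos :: real
  dir :: heading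
  speed :: real
  alarm :: real
  attempts :: nat
  view :: "percept list"

record config =
  now :: real
  ag :: "agent \<Rightarrow> agent_state"

definition velocity :: "agent_state \<Rightarrow> real" where
  "velocity s = sign (dir s) * speed s"

definition co_located :: "config \<Rightarrow> bool" where
  "co_located c \<longleftrightarrow> pos (ag c Agent1) = pos (ag c Agent2)"

definition linked :: "comm_model \<Rightarrow> config \<Rightarrow> bool" where
  "linked M c \<longleftrightarrow> M = Wireless \<or> co_located c"

text \<open>
  The percept of agent \<open>i\<close> at an event.  The message also contains what the other
  agent senses at this very instant, since messages are instantaneous.
\<close>

definition sense :: "real \<Rightarrow> config \<Rightarrow> agent \<Rightarrow> percept list option \<Rightarrow> percept" where
  "sense x c i m =
     Percept (now c) (pos (ag c i) = 0) (pos (ag c i) = x) (co_located c) m"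

definition perceive :: "comm_model \<Rightarrow> real \<Rightarrow> config \<Rightarrow> agent \<Rightarrow> percept" where
  "perceive M x c i = sense x c i
     (if linked M c then Some (view (ag c (other i)) @ [sense x c (other i) None]) else None)"

text \<open>
  \<open>react M x P \<omega> W c\<close>: the agents in \<open>W\<close> act in configuration \<open>c\<close>.
  \<open>\<omega> (i, k)\<close> tells whether the \<open>k\<close>-th attempt of agent \<open>i\<close> to change direction fails.
  A pick-up takes effect only if the agents are at the same place, the carrier was moving, and
  the agent picked up attempts neither a turn nor a pick-up at the same time; the latter then
  adopts the direction of the carrier without fault.
\<close>

definition react ::
  "comm_model \<Rightarrow> real \<Rightarrow> protocol \<Rightarrow> (agent \<times> nat \<Rightarrow> bool) \<Rightarrow> agent set \<Rightarrow> config \<Rightarrow> config" where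
  "react M x P \<omega> W c =
    (let new_view = (\<lambda>i. if i \<in> W then view (ag c i) @ [perceive M x c i] else view (ag c i));
         act = (\<lambda>i. decide P i (new_view i));
         man = (\<lambda>i. if i \<in> W then manoeuvre (act i) else Continue);
         carries = (\<lambda>i. man i = Pick_Up \<and> man (other i) = Continue
                        \<and> co_located c \<and> 0 < speed (ag c i))
     in c\<lparr>ag := (\<lambda>i. let s = ag c i in
          \<lparr>pos = pos s,
           dir = (if carries (other i) then dir (ag c (other i))
                  else if man i = Turn \<and> \<not> \<omega> (i, attempts s) then opposite (dir s)
                  else dir s),
           speed = (if i \<in> W then new_speed (act i) else speed s),
           alarm = (if i \<in> W then now c + timeout (act i) else alarm s),
           attempts = (if man i = Turn then Suc (attempts s) else attempts s),
           view = new_view i\<rparr>)\<rparr>)"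

text \<open>
  The set of delays (empty or a singleton) after which a quantity with current value \<open>d\<close> and
  rate of change \<open>v\<close> becomes zero, having been nonzero before.  Hence a meeting is an event
  when it begins, but not while the agents keep travelling together.
\<close>

definition hits :: "real \<Rightarrow> real \<Rightarrow> real set" where
  "hits d v = (if d * v < 0 then {- d / v} else {})"

definition trigger_delays :: "real \<Rightarrow> config \<Rightarrow> agent \<Rightarrow> real set" where
  "trigger_delays x c i =
     (let s = ag c i; s' = ag c (other i) in
      {alarm s - now c} \<union> hits (pos s) (velocity s) \<union> hits (pos s - x) (velocity s)
      \<union> hits (pos s - pos s') (velocity s - velocity s'))"

definition next_delay :: "real \<Rightarrow> config \<Rightarrow> real" where
  "next_delay x c = Min (trigger_delays x c Agent1 \<union> trigger_delays x c Agent2)"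

definition advance :: "real \<Rightarrow> config \<Rightarrow> config" where
  "advance t c = \<lparr>now = now c + t,
     ag = (\<lambda>i. (ag c i)\<lparr>pos := pos (ag c i) + t * velocity (ag c i)\<rparr>)\<rparr>"

definition woken :: "comm_model \<Rightarrow> real \<Rightarrow> config \<Rightarrow> agent set" where
  "woken M x c =
     (let t = next_delay x c in
      {i. t \<in> trigger_delays x c i
          \<or> (linked M (advance t c) \<and> t \<in> trigger_delays x c (other i))})"

definition step ::
  "comm_model \<Rightarrow> real \<Rightarrow> protocol \<Rightarrow> (agent \<times> nat \<Rightarrow> bool) \<Rightarrow> config \<Rightarrow> config" where
  "step M x P \<omega> c = react M x P \<omega> (woken M x c) (advance (next_delay x c) c)"

definition initial :: "protocol \<Rightarrow> config" where
  "initial P = \<lparr>now = 0, ag = (\<lambda>i. \<lparr>pos = 0, dir = start_heading P i, speed = 0, alarm = 0,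
     attempts = 0, view = []\<rparr>)\<rparr>"

text \<open>The configuration right after the \<open>n\<close>-th event; event \<open>0\<close> is the common start.\<close>

primrec run ::
  "comm_model \<Rightarrow> real \<Rightarrow> protocol \<Rightarrow> (agent \<times> nat \<Rightarrow> bool) \<Rightarrow> nat \<Rightarrow> config" where
  "run M x P \<omega> 0 = react M x P \<omega> UNIV (initial P)"
| "run M x P \<omega> (Suc n) = step M x P \<omega> (run M x P \<omega> n)"

text \<open>
  Walking over the target is an event, so it suffices to inspect the positions at events.
  The infimum is \<open>\<infinity>\<close> if the target is never reached.  If infinitely many
  events happen in finite time, nothing after their accumulation point counts.
\<close>

definition arrival_time ::
  "comm_model \<Rightarrow> protocol \<Rightarrow> real \<Rightarrow> (agent \<times> nat \<Rightarrow> bool) \<Rightarrow> agent \<Rightarrow> ennreal" where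
  "arrival_time M P x \<omega> i =
     (INF n \<in> {n. pos (ag (run M x P \<omega> n) i) = x}. ennreal (now (run M x P \<omega> n)))"

definition search_time ::
  "comm_model \<Rightarrow> protocol \<Rightarrow> real \<Rightarrow> (agent \<times> nat \<Rightarrow> bool) \<Rightarrow> ennreal" where
  "search_time M P x \<omega> = max (arrival_time M P x \<omega> Agent1) (arrival_time M P x \<omega> Agent2)"


subsection \<open>Performance\<close>

definition faults :: "real \<Rightarrow> (agent \<times> nat \<Rightarrow> bool) measure" where
  "faults p = (\<Pi>\<^sub>M k\<in>UNIV. measure_pmf (bernoulli_pmf p))"

definition solves_PDLS :: "real \<Rightarrow> comm_model \<Rightarrow> protocol \<Rightarrow> bool" where
  "solves_PDLS p M P \<longleftrightarrow> (\<forall>x. search_time M P x \<in> borel_measurable (faults p)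
     \<and> (AE \<omega> in faults p. search_time M P x \<omega> < \<infinity>))"

definition expected_time :: "real \<Rightarrow> comm_model \<Rightarrow> protocol \<Rightarrow> real \<Rightarrow> ennreal" where
  "expected_time p M P x = (\<integral>\<^sup>+ \<omega>. search_time M P x \<omega> \<partial>faults p)"

text \<open>For real numbers, the filter \<open>at_infinity\<close> expresses that \<open>\<bar>x\<bar>\<close> tends to infinity.\<close>

definition competitive_ratio :: "real \<Rightarrow> comm_model \<Rightarrow> protocol \<Rightarrow> ennreal" where
  "competitive_ratio p M P = Limsup at_infinity (\<lambda>x. expected_time p M P x / ennreal \<bar>x\<bar>)"

text \<open>
  For all targets far enough from the origin, with probability arbitrarily close to 1, the
  performance \<open>search_time / \<bar>x\<bar>\<close> of a run is at most \<open>r + \<delta>\<close> and differs from its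
  expectation by at most \<open>\<delta>\<close>.  The inequalities are multiplied by \<open>\<bar>x\<bar>\<close> and
  free of subtraction because they are stated in the extended nonnegative reals.
\<close>

definition performance_concentrated :: "real \<Rightarrow> comm_model \<Rightarrow> protocol \<Rightarrow> real \<Rightarrow> bool" where
  "performance_concentrated p M P r \<longleftrightarrow>
     (\<forall>\<delta>>0. \<forall>\<eta>>0. \<forall>\<^sub>F x in at_infinity.
        measure (faults p)
          {\<omega> \<in> space (faults p).
             search_time M P x \<omega> \<le> ennreal ((r + \<delta>) * \<bar>x\<bar>)
             \<and> search_time M P x \<omega> \<le> expected_time p M P x + ennreal (\<delta> * \<bar>x\<bar>)
             \<and> expected_time p M P x \<le> search_time M P x \<omega> + ennreal (\<delta> * \<bar>x\<bar>)}
        \<ge> 1 - \<eta>)"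

end

theory Submission
  imports Defs "HOL-Real_Asymp.Real_Asymp"
begin

text \<open>
  The agents travel together along the zigzag with turning points
  \<open>y\<^sub>k = ((-2)\<^sup>k + 2) / 3\<close>.  Leg \<open>k \<ge> 1\<close> has length \<open>2\<^sup>k\<close> and starts without faults
  at time \<open>2\<^sup>k - 2\<close>, and a target met first in leg \<open>k\<close> satisfies \<open>2\<^sup>k \<le> 6 \<bar>x\<bar> + 4\<close>, whence the
  ratio 9.  To turn the pair, the second agent halts as a landmark while the first walks on to
  distance 1 and attempts to turn.  If it does not meet the landmark when it should, the attempt
  has failed, it is now at twice the distance, and it tries again; otherwise it knows that it
  walks back and picks up the other agent.  The \<open>j\<close>-th attempt costs time \<open>2\<^bsup>j-1\<^esup>\<close> and takes place
  with probability \<open>p\<^bsup>j-1\<^esup>\<close>, so for \<open>p < 1/2\<close> a turn takes bounded expected time.  The number of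
  turns before \<open>x\<close> is reached is logarithmic in \<open>\<bar>x\<bar>\<close>, so the delay is negligible, both in
  expectation and, by Markov's inequality, with high probability.  Agents act only at deadlines
  known to both of them and never use messages; this makes the protocol independent of the
  communication model.
\<close>

section \<open>The protocol\<close>

text \<open>
  An agent's memory is a triple of the leg \<open>k\<close>, the stage \<open>j\<close> and the deadline of the stage.
  Stage 0 is the joint walk, stage 1 the first agent's walk ahead, and stage \<open>j \<ge> 2\<close> its
  \<open>(j - 1)\<close>-th attempt to turn, from distance \<open>2\<^bsup>j-2\<^esup>\<close>.  For \<open>j = 1\<close>, truncated subtraction gives
  the desired duration 1.
\<close>

fun duration :: "nat \<Rightarrow> nat \<Rightarrow> real" where
  "duration k j = (if j = 0 then 2 ^ k else 2 ^ (j - 2))"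

lemma duration_ge_1: "1 \<le> duration k j"
  by simp

declare duration.simps [simp del]

text \<open>Only the clock and the meeting bit are used, on which both agents agree at a deadline;
  so their memories stay equal without messages.\<close>

fun observe :: "nat \<times> nat \<times> real \<Rightarrow> percept \<Rightarrow> nat \<times> nat \<times> real" where
  "observe (k, j, d) q =
    (if clock q < d then (k, j, d)
     else if j = 0 then (k, 1, clock q + duration k 1)
     else if meeting q then (Suc k, 0, clock q + duration (Suc k) 0)
     else (k, Suc j, clock q + duration k (Suc j)))"

text \<open>Starting from stage 1 of leg 0 with deadline 0, the meeting at the common start initiates leg 1.\<close>

definition memory :: "percept list \<Rightarrow> nat \<times> nat \<times> real" where
  "memory = foldl observe (0, 1, 0)"

lemma memory_simps [simp]:
  "memory [] = (0, 1, 0)"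
  "memory (h @ [q]) = observe (memory h) q"
  by (simp_all add: memory_def)

text \<open>\<open>Agent2\<close> is reversed only by being picked up, so never subject to a fault.
  At the common start the pick-up is void, as \<open>Agent1\<close> has speed 0, but both agents
  face right anyway.\<close>

fun command :: "agent \<Rightarrow> nat \<Rightarrow> manoeuvre" where
  "command Agent1 j = (if j = 0 then Pick_Up else if j = 1 then Continue else Turn)"
| "command Agent2 j = Continue"

fun pace :: "agent \<Rightarrow> nat \<Rightarrow> real" where
  "pace Agent1 j = 1"
| "pace Agent2 j = (if j = 0 then 1 else 0)"

text \<open>An agent woken early repeats its pace and resets its alarm to the same deadline; a
  manoeuvre is made only on entering a stage. Telling the two apart requires the old deadline, hence
  the memory before the last percept.\<close>

definition respond :: "agent \<Rightarrow> nat \<times> nat \<times> real \<Rightarrow> percept \<Rightarrow> action" where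
  "respond i r q = (case observe r q of (k, j, d) \<Rightarrow>
     \<lparr>manoeuvre = (if clock q < snd (snd r) then Continue else command i j),
      new_speed = pace i j, timeout = d - clock q\<rparr>)"

definition zigzag :: protocol where
  "zigzag = \<lparr>start_heading = (\<lambda>_. Rightward),
     decide = (\<lambda>i h. respond i (memory (butlast h)) (last h))\<rparr>"

lemma decide_zigzag [simp]: "decide zigzag i (h @ [q]) = respond i (memory h) q"
  by (simp add: zigzag_def)

lemma pace_bounds: "0 \<le> pace i j" "pace i j \<le> 1"
  by (cases i; simp)+

lemma admissible_zigzag: "admissible zigzag"
proof -
  have "0 < timeout (respond i r q) \<and> 0 \<le> new_speed (respond i r q)
      \<and> new_speed (respond i r q) \<le> 1" for i r q
    using duration_ge_1 less_le_trans[OF zero_less_one duration_ge_1]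
    by (cases r) (auto simp: respond_def pace_bounds)
  then show ?thesis
    by (simp add: admissible_def zigzag_def)
qed


section \<open>Segments of an execution\<close>

text \<open>Leg \<open>k\<close> starts here: at 0, 2, -2, 6 for
  \<open>k = 1, 2, 3, 4\<close>.\<close>

definition turning_point :: "nat \<Rightarrow> real" where
  "turning_point k = ((-2) ^ k + 2) / 3"

definition course :: "nat \<Rightarrow> heading" where
  "course k = (if odd k then Rightward else Leftward)"

lemma course_Suc: "course (Suc k) = opposite (course k)"
  by (simp add: course_def)

lemma sign_opposite [simp]: "sign (opposite h) = - sign h"
  by (cases h) simp_all

lemma sign_neq_0 [simp]: "sign h \<noteq> 0"
  by (cases h) simp_all

lemma turning_point_Suc: "turning_point (Suc k) = turning_point k + sign (course k) * 2 ^ k"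
  by (cases "even k") (simp_all add: turning_point_def course_def uminus_power_if field_simps)

text \<open>
  A segment is the part of an execution between two deadlines; \<open>outward\<close> tells whether the first
  agent still has the direction of the leg, and \<open>tries\<close> counts its attempts so far.
\<close>

record segment =
  phase :: nat
  stage :: nat
  outward :: bool
  tries :: nat
  since :: real

definition expiry :: "segment \<Rightarrow> real" where
  "expiry s = since s + duration (phase s) (stage s)"

definition next_segment :: "(agent \<times> nat \<Rightarrow> bool) \<Rightarrow> segment \<Rightarrow> segment" where
  "next_segment \<omega> s =
    (if stage s = 0 then \<lparr>phase = phase s, stage = 1, outward = True, tries = tries s, since = expiry s\<rparr>
     else if outward s then \<lparr>phase = phase s, stage = Suc (stage s),
       outward = \<omega> (Agent1, tries s), tries = Suc (tries s), since = expiry s\<rparr>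
     else \<lparr>phase = Suc (phase s), stage = 0, outward = True, tries = tries s, since = expiry s\<rparr>)"

lemma since_next_segment [simp]: "since (next_segment \<omega> s) = expiry s"
  by (simp add: next_segment_def)

definition first_segment :: segment where
  "first_segment = \<lparr>phase = 1, stage = 0, outward = True, tries = 0, since = 0\<rparr>"

definition segment_at :: "(agent \<times> nat \<Rightarrow> bool) \<Rightarrow> nat \<Rightarrow> segment" where
  "segment_at \<omega> b = (next_segment \<omega> ^^ b) first_segment"

lemma segment_at_simps [simp]:
  "segment_at \<omega> 0 = first_segment"
  "segment_at \<omega> (Suc b) = next_segment \<omega> (segment_at \<omega> b)"
  by (simp_all add: segment_at_def)

fun facing :: "segment \<Rightarrow> agent \<Rightarrow> heading" where
  "facing s Agent1 = (if outward s then course (phase s) else opposite (course (phase s)))"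
| "facing s Agent2 = course (phase s)"

fun base :: "segment \<Rightarrow> agent \<Rightarrow> real" where
  "base s Agent1 = (if stage s = 0 then turning_point (phase s) else turning_point (Suc (phase s))
     + (if stage s = 1 then 0 else sign (course (phase s)) * 2 ^ (stage s - 2)))"
| "base s Agent2 = (if stage s = 0 then turning_point (phase s) else turning_point (Suc (phase s)))"

definition drift :: "segment \<Rightarrow> agent \<Rightarrow> real" where
  "drift s i = sign (facing s i) * pace i (stage s)"

definition place :: "segment \<Rightarrow> agent \<Rightarrow> real \<Rightarrow> real" where
  "place s i t = base s i + (t - since s) * drift s i"

text \<open>Half-open in time: at a deadline the agents have already reacted, and the configuration
  belongs to the next segment.\<close>

definition in_segment :: "segment \<Rightarrow> config \<Rightarrow> bool" where
  "in_segment s c \<longleftrightarrow> since s \<le> now c \<and> now c < expiry s \<and>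
     (\<forall>i. pos (ag c i) = place s i (now c) \<and> dir (ag c i) = facing s i
        \<and> speed (ag c i) = pace i (stage s) \<and> alarm (ag c i) = expiry s
        \<and> memory (view (ag c i)) = (phase s, stage s, expiry s))
     \<and> attempts (ag c Agent1) = tries s \<and> (stage s \<le> 1 \<longrightarrow> outward s)"

lemma all_agent: "(\<forall>i. Q i) \<longleftrightarrow> Q Agent1 \<and> Q Agent2"
  using agent.exhaust by metis

lemma since_less_expiry: "since s < expiry s"
  using duration_ge_1[of "phase s" "stage s"] by (simp add: expiry_def)

lemma in_first_segment: "in_segment first_segment (run M x zigzag \<omega> 0)"
  by (auto simp: in_segment_def first_segment_def react_def Let_def initial_def perceive_def
      sense_def co_located_def respond_def all_agent expiry_def duration.simps turning_point_def
      place_def course_def zigzag_def memory_def)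

text \<open>This is how a fault is detected: the stage lasts exactly as long as the way back to the
  landmark, whereas walking on doubles the distance.\<close>

lemma meet_at_expiry_iff:
  assumes "stage s \<le> 1 \<longrightarrow> outward s"
  shows "place s Agent1 (expiry s) = place s Agent2 (expiry s) \<longleftrightarrow> stage s = 0 \<or> \<not> outward s"
  using assms by (auto simp: place_def expiry_def drift_def duration.simps algebra_simps)

text \<open>The outcome of a turn at the deadline affects the heading but not the position, so
  \<open>\<omega>\<close> is arbitrary.\<close>

lemma place_at_expiry:
  assumes "stage s \<le> 1 \<longrightarrow> outward s"
  shows "place s i (expiry s) = base (next_segment \<omega> s) i"
proof (cases i)
  case Agent1
  consider "stage s = 0" | "stage s = 1" | n where "stage s = Suc (Suc n)"
    by (metis One_nat_def old.nat.exhaust)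
  then show ?thesis
    using assms Agent1
    by cases (auto simp: place_def expiry_def drift_def next_segment_def duration.simps
        turning_point_Suc algebra_simps)
next
  case Agent2
  then show ?thesis
    using assms by (auto simp: place_def expiry_def drift_def next_segment_def duration.simps
        turning_point_Suc algebra_simps)
qed

section \<open>Event times and single steps\<close>

lemma hitsD: "u \<in> hits d v \<Longrightarrow> 0 < u \<and> d + u * v = 0 \<and> v \<noteq> 0"
  by (auto simp: hits_def field_simps mult_less_0_iff split: if_splits)

lemma hitsI: "d + u * v = 0 \<Longrightarrow> v \<noteq> 0 \<Longrightarrow> 0 < u \<Longrightarrow> u \<in> hits d v"
  by (auto simp: hits_def field_simps mult_less_0_iff add_eq_0_iff2 zero_less_mult_iff)

lemma finite_hits [simp]: "finite (hits d v)"
  by (simp add: hits_def)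

lemma finite_trigger_delays: "finite (trigger_delays x c i)"
  by (simp add: trigger_delays_def Let_def)

lemma next_delay_in:
  "next_delay x c \<in> trigger_delays x c Agent1 \<union> trigger_delays x c Agent2"
  unfolding next_delay_def
  by (intro Min_in) (auto simp: finite_trigger_delays trigger_delays_def Let_def)

lemma next_delay_le: "u \<in> trigger_delays x c i \<Longrightarrow> next_delay x c \<le> u"
  unfolding next_delay_def by (cases i) (auto intro!: Min_le simp: finite_trigger_delays)

lemma alarm_in_trigger_delays: "alarm (ag c i) - now c \<in> trigger_delays x c i"
  by (simp add: trigger_delays_def Let_def)

lemma advance_simps [simp]:
  "now (advance t c) = now c + t"
  "pos (ag (advance t c) i) = pos (ag c i) + t * velocity (ag c i)"
  "dir (ag (advance t c) i) = dir (ag c i)"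
  "speed (ag (advance t c) i) = speed (ag c i)"
  "alarm (ag (advance t c) i) = alarm (ag c i)"
  "attempts (ag (advance t c) i) = attempts (ag c i)"
  "view (ag (advance t c) i) = view (ag c i)"
  by (simp_all add: advance_def)

lemma now_react [simp]: "now (react M x P \<omega> W c) = now c"
  and pos_react [simp]: "pos (ag (react M x P \<omega> W c) i) = pos (ag c i)"
  by (simp_all add: react_def Let_def)

lemma clock_perceive [simp]: "clock (perceive M x c i) = now c"
  and meeting_perceive [simp]: "meeting (perceive M x c i) = co_located c"
  by (simp_all add: perceive_def sense_def)

lemma now_run_Suc:
  "now (run M x P \<omega> (Suc n)) = now (run M x P \<omega> n) + next_delay x (run M x P \<omega> n)"
  by (simp add: step_def)

lemma pos_run_Suc:
  "pos (ag (run M x P \<omega> (Suc n)) i) = pos (ag (run M x P \<omega> n) i)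
     + next_delay x (run M x P \<omega> n) * velocity (ag (run M x P \<omega> n) i)"
  by (simp add: step_def)

declare run.simps(2) [simp del]

lemma velocity_in_segment: "in_segment s c \<Longrightarrow> velocity (ag c i) = drift s i"
  by (simp add: in_segment_def velocity_def drift_def)

lemma next_delay_pos:
  assumes "in_segment s c"
  shows "0 < next_delay x c"
proof -
  have "0 < u" if "u \<in> trigger_delays x c i" for u i
    using that assms by (auto simp: trigger_delays_def Let_def in_segment_def dest: hitsD)
  then show ?thesis
    using next_delay_in[of x c] by blast
qed

lemma next_delay_le_expiry:
  assumes "in_segment s c"
  shows "now c + next_delay x c \<le> expiry s"
  using next_delay_le[OF alarm_in_trigger_delays, of x c Agent1] assms by (simp add: in_segment_def)

text \<open>Meetings and visits to the origin or the target before the deadline may wake agents, but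
  change neither motion nor memory.\<close>

lemma step_within_segment:
  assumes c: "in_segment s c" and lt: "now c + next_delay x c < expiry s"
  shows "in_segment s (step M x zigzag \<omega> c)"
  using next_delay_pos[OF c, of x] lt c velocity_in_segment[OF c]
  by (auto simp: in_segment_def step_def react_def Let_def respond_def place_def algebra_simps)

lemma step_to_next_segment:
  assumes c: "in_segment s c" and eq: "now c + next_delay x c = expiry s"
  shows "in_segment (next_segment \<omega> s) (step M x zigzag \<omega> c)"
proof -
  define c' where "c' = advance (next_delay x c) c"
  \<comment> \<open>Both alarms are due now, so both agents act whatever the communication
    model.\<close>
  have W: "woken M x c = UNIV"
  proof -
    have "next_delay x c = alarm (ag c i) - now c" for i
      using c eq by (simp add: in_segment_def)
    then have "next_delay x c \<in> trigger_delays x c i" for i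
      using alarm_in_trigger_delays[of c i x] by metis
    then show ?thesis
      by (simp add: woken_def Let_def)
  qed
  have valid: "stage s \<le> 1 \<longrightarrow> outward s"
    using c by (simp add: in_segment_def)
  have now: "now c' = expiry s"
    using eq by (simp add: c'_def)
  have pos: "pos (ag c' i) = place s i (expiry s)" for i
    using c velocity_in_segment[OF c] unfolding eq[symmetric]
    by (simp add: c'_def in_segment_def place_def algebra_simps)
  have co: "co_located c' \<longleftrightarrow> stage s = 0 \<or> \<not> outward s"
    using meet_at_expiry_iff[OF valid] by (simp add: co_located_def pos)
  have fields: "dir (ag c' i) = facing s i" "speed (ag c' i) = pace i (stage s)"
    "memory (view (ag c' i)) = (phase s, stage s, expiry s)" for i
    using c by (simp_all add: c'_def in_segment_def)
  have tries: "attempts (ag c' Agent1) = tries s"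
    using c by (simp add: c'_def in_segment_def)
  have place: "place (next_segment \<omega> s) i (expiry s) = place s i (expiry s)" for i
    using place_at_expiry[OF valid] by (simp add: place_def[of "next_segment \<omega> s"])
  have "in_segment (next_segment \<omega> s) (react M x zigzag \<omega> UNIV c')"
    unfolding in_segment_def
    apply (intro conjI)
    subgoal by (simp add: now next_segment_def)
    subgoal using since_less_expiry[of "next_segment \<omega> s"] by (simp add: now)
    \<comment> \<open>When a new leg begins, \<open>Agent2\<close> adopts the heading of the
      returning \<open>Agent1\<close>, which is the course of that leg.\<close>
    subgoal
      using valid
      by (simp add: pos place now)
        (auto simp: react_def Let_def respond_def now co fields tries next_segment_def all_agent
          expiry_def course_Suc)
    subgoal by (simp add: react_def Let_def respond_def now co fields tries next_segment_def)
    subgoal by (simp add: next_segment_def)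
    done
  then show ?thesis
    by (simp add: step_def W c'_def)
qed


section \<open>Finitely many events in a segment\<close>

text \<open>A superset of the possible event times that does not depend on the current
  configuration. If a rate is 0, division by zero merely contributes \<open>since s\<close>.\<close>

definition crossings :: "real \<Rightarrow> segment \<Rightarrow> real set" where
  "crossings x s = {expiry s} \<union> (\<Union>i\<in>{Agent1, Agent2}.
     {since s - base s i / drift s i, since s - (base s i - x) / drift s i,
      since s - (base s i - base s (other i)) / (drift s i - drift s (other i))})"

lemma finite_crossings: "finite (crossings x s)"
  by (simp add: crossings_def)

text \<open>The signed distances passed to \<open>hits\<close> are linear in time throughout the
  segment, so their zeros do not depend on when the delay is measured.\<close>

lemma next_event_in_crossings:
  assumes c: "in_segment s c"
  shows "now c + next_delay x c \<in> crossings x s"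
proof -
  have eq: "now c + u = since s - d / v" if "u \<in> hits (d + (now c - since s) * v) v" for u d v
    using hitsD[OF that] by (auto simp: field_simps)
  have pos: "pos (ag c i) = base s i + (now c - since s) * drift s i" for i
    using c by (simp add: in_segment_def place_def)
  have "now c + u \<in> crossings x s" if u: "u \<in> trigger_delays x c i" for u i
  proof -
    have i: "i \<in> {Agent1, Agent2}"
      by (cases i) auto
    from u consider "u = alarm (ag c i) - now c"
      | "u \<in> hits (base s i + (now c - since s) * drift s i) (drift s i)"
      | "u \<in> hits ((base s i - x) + (now c - since s) * drift s i) (drift s i)"
      | "u \<in> hits ((base s i - base s (other i))
            + (now c - since s) * (drift s i - drift s (other i))) (drift s i - drift s (other i))"
      unfolding trigger_delays_def Let_def velocity_in_segment[OF c] pos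
      by (auto simp: algebra_simps)
    then show ?thesis
    proof cases
      case 1
      then show ?thesis
        using c by (simp add: crossings_def in_segment_def)
    qed (use i in \<open>auto dest!: eq simp: crossings_def\<close>)
  qed
  then show ?thesis
    using next_delay_in[of x c] by blast
qed

text \<open>Within a segment, events happen only at its finitely many crossing times, so that
  events cannot accumulate.\<close>

lemma event_at:
  assumes "in_segment s (run M x zigzag \<omega> n)" and "now (run M x zigzag \<omega> n) \<le> \<tau>"
    and "\<tau> \<le> expiry s"
    and stop: "\<And>c. in_segment s c \<Longrightarrow> now c < \<tau> \<Longrightarrow> now c + next_delay x c \<le> \<tau>"
  shows "\<exists>m. now (run M x zigzag \<omega> m) = \<tau> \<and> (\<forall>i. pos (ag (run M x zigzag \<omega> m) i) = place s i \<tau>)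
    \<and> (\<tau> = expiry s \<longrightarrow> in_segment (next_segment \<omega> s) (run M x zigzag \<omega> m))"
  using assms(1,2)
\<comment> \<open>The measure counts the crossing times still ahead; \<open>stop\<close> prevents an
  event from jumping over \<open>\<tau>\<close>.\<close>
proof (induction "card {u \<in> crossings x s. now (run M x zigzag \<omega> n) < u}" arbitrary: n
    rule: less_induct)
  case less
  let ?c = "run M x zigzag \<omega> n"
  have pos: "pos (ag ?c i) = place s i (now ?c)" for i
    using less.prems by (simp add: in_segment_def)
  have pos_Suc: "pos (ag (run M x zigzag \<omega> (Suc n)) i) = place s i (now (run M x zigzag \<omega> (Suc n)))" for i
    using pos velocity_in_segment[OF less.prems(1)]
    by (simp add: pos_run_Suc now_run_Suc place_def algebra_simps)
  show ?case
  proof (cases "now ?c < \<tau>")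
    case False
    then have "now ?c = \<tau>" "\<tau> \<noteq> expiry s"
      using less.prems by (auto simp: in_segment_def)
    with pos show ?thesis
      by auto
  next
    case True
    show ?thesis
    proof (cases "now ?c + next_delay x ?c < expiry s")
      case False
      then have eq: "now ?c + next_delay x ?c = expiry s"
        using next_delay_le_expiry[OF less.prems(1), of x] by simp
      then have \<tau>: "now (run M x zigzag \<omega> (Suc n)) = \<tau>"
        using stop[OF less.prems(1) True] \<open>\<tau> \<le> expiry s\<close> by (simp add: now_run_Suc)
      have "in_segment (next_segment \<omega> s) (run M x zigzag \<omega> (Suc n))"
        using step_to_next_segment[OF less.prems(1) eq] by (simp only: run.simps(2))
      then show ?thesis
        using \<tau> pos_Suc[unfolded \<tau>] by blast
    next
      case lt: True
      let ?c' = "run M x zigzag \<omega> (Suc n)"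
      have seg: "in_segment s ?c'"
        using step_within_segment[OF less.prems(1) lt, of M \<omega>] by (simp add: run.simps(2))
      have now: "now ?c' = now ?c + next_delay x ?c"
        by (simp add: now_run_Suc)
      have "now ?c < now ?c'" "now ?c' \<in> crossings x s"
        using next_event_in_crossings[OF less.prems(1), of x] next_delay_pos[OF less.prems(1), of x]
        by (simp_all add: now)
      then have "{u \<in> crossings x s. now ?c' < u} \<subset> {u \<in> crossings x s. now ?c < u}"
        by fastforce
      then have "card {u \<in> crossings x s. now ?c' < u} < card {u \<in> crossings x s. now ?c < u}"
        by (intro psubset_card_mono) (simp_all add: finite_crossings)
      moreover have "now ?c' \<le> \<tau>"
        using stop[OF less.prems(1) True] by (simp add: now)
      ultimately show ?thesis
        using less.hyps[OF _ seg] by blast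
    qed
  qed
qed


section \<open>Correspondence between events and segments\<close>

lemma some_event_at_start:
  "\<exists>n. in_segment (segment_at \<omega> b) (run M x zigzag \<omega> n)
    \<and> now (run M x zigzag \<omega> n) = since (segment_at \<omega> b)"
proof (induction b)
  case 0
  have "now (run M x zigzag \<omega> 0) = since first_segment"
    by (simp add: initial_def first_segment_def)
  then show ?case
    using in_first_segment by (metis segment_at_simps(1))
next
  case (Suc b)
  then obtain n where "in_segment (segment_at \<omega> b) (run M x zigzag \<omega> n)"
    by blast
  then have "\<exists>m. now (run M x zigzag \<omega> m) = expiry (segment_at \<omega> b)
      \<and> in_segment (next_segment \<omega> (segment_at \<omega> b)) (run M x zigzag \<omega> m)"
    using event_at[of "segment_at \<omega> b" M x \<omega> n "expiry (segment_at \<omega> b)"] next_delay_le_expiry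
    by (auto simp: in_segment_def)
  then show ?case
    by auto
qed

text \<open>Needed to exclude earlier visits of \<open>Agent2\<close> to the target.\<close>

lemma run_in_some_segment: "\<exists>b. in_segment (segment_at \<omega> b) (run M x zigzag \<omega> n)"
proof (induction n)
  case 0
  show ?case
    using in_first_segment by (metis segment_at_simps(1))
next
  case (Suc n)
  then obtain b where b: "in_segment (segment_at \<omega> b) (run M x zigzag \<omega> n)" ..
  show ?case
  proof (cases "now (run M x zigzag \<omega> n) + next_delay x (run M x zigzag \<omega> n) < expiry (segment_at \<omega> b)")
    case True
    then show ?thesis
      using step_within_segment[OF b, of x M \<omega>] by (auto simp: run.simps(2))
  next
    case False
    then have "now (run M x zigzag \<omega> n) + next_delay x (run M x zigzag \<omega> n) = expiry (segment_at \<omega> b)"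
      using next_delay_le_expiry[OF b, of x] by simp
    then show ?thesis
      using step_to_next_segment[OF b, of x \<omega> M] by (metis run.simps(2) segment_at_simps(2))
  qed
qed

section \<open>Order and timing of the segments\<close>

lemma phase_segment_at_mono: "b \<le> b' \<Longrightarrow> phase (segment_at \<omega> b) \<le> phase (segment_at \<omega> b')"
  by (rule lift_Suc_mono_le[of "\<lambda>b. phase (segment_at \<omega> b)"]) (simp_all add: next_segment_def)

lemma since_segment_at_mono: "b \<le> b' \<Longrightarrow> since (segment_at \<omega> b) \<le> since (segment_at \<omega> b')"
  by (rule lift_Suc_mono_le[of "\<lambda>b. since (segment_at \<omega> b)"])
    (simp_all add: less_imp_le[OF since_less_expiry])

lemma since_segment_at_ge: "real b \<le> since (segment_at \<omega> b)"
proof (induction b)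
  case (Suc b)
  then show ?case
    using duration_ge_1[of "phase (segment_at \<omega> b)" "stage (segment_at \<omega> b)"]
    by (simp add: expiry_def)
qed (simp add: first_segment_def)

text \<open>The phase grows by at most one per segment, and only on entering stage 0.\<close>

lemma first_segment_of_phase:
  assumes "1 \<le> K" and "K \<le> phase (segment_at \<omega> b)"
    and less: "\<And>b'. b' < b \<Longrightarrow> phase (segment_at \<omega> b') < K"
  shows "phase (segment_at \<omega> b) = K" and "stage (segment_at \<omega> b) = 0"
proof -
  have "phase (segment_at \<omega> b) = K \<and> stage (segment_at \<omega> b) = 0"
  proof (cases b)
    case 0
    then show ?thesis
      using assms by (simp add: first_segment_def)
  next
    case (Suc b')
    then show ?thesis
      using less[of b'] assms(2) by (auto simp: next_segment_def split: if_splits)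
  qed
  then show "phase (segment_at \<omega> b) = K" "stage (segment_at \<omega> b) = 0"
    by simp_all
qed

text \<open>The walks of legs 1 to \<open>k - 1\<close> alone take \<open>2 ^ k - 2\<close>. The
  extra summand, for a completed walk of leg \<open>k\<close>, makes the induction work.\<close>

lemma since_segment_at_ge_power:
  "2 ^ phase (segment_at \<omega> b) - 2 + (if stage (segment_at \<omega> b) = 0 then 0 else 2 ^ phase (segment_at \<omega> b))
    \<le> since (segment_at \<omega> b)"
proof (induction b)
  case 0
  then show ?case
    by (simp add: first_segment_def)
next
  case (Suc b)
  let ?s = "segment_at \<omega> b"
  have "expiry ?s \<ge> since ?s" "stage ?s = 0 \<Longrightarrow> expiry ?s = since ?s + 2 ^ phase ?s"
    using since_less_expiry[of ?s] by (simp_all add: expiry_def duration.simps)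
  then show ?case
    using Suc by (auto simp: next_segment_def)
qed


section \<open>The search time\<close>

definition in_leg :: "nat \<Rightarrow> real \<Rightarrow> bool" where
  "in_leg k x \<longleftrightarrow> 0 \<le> sign (course k) * (x - turning_point k)
     \<and> sign (course k) * (x - turning_point k) \<le> 2 ^ k"

definition leg_of :: "real \<Rightarrow> nat" where
  "leg_of x = (LEAST k. 1 \<le> k \<and> in_leg k x)"

lemma sign_mult_sign [simp]:
  "sign h * sign h = 1" "sign h * (sign h * u) = u" "sign h * (u * sign h) = u"
  by (cases h; simp)+

lemma abs_sign_mult [simp]: "\<bar>sign h * u\<bar> = \<bar>u\<bar>"
  by (cases h) simp_all

lemma leg_of: "1 \<le> leg_of x" "in_leg (leg_of x) x"
proof -
  \<comment> \<open>Large enough for the ends of leg \<open>Suc n\<close> to lie on different sides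
    of 0, each farther away than \<open>\<bar>x\<bar>\<close>.\<close>
  obtain n :: nat where n: "3 * \<bar>x\<bar> + 2 < 2 ^ n"
    using real_arch_pow[of 2] by auto
  have "in_leg (Suc n) x"
    using n by (cases "even n")
      (auto simp: in_leg_def course_def turning_point_def uminus_power_if abs_if field_simps
        split: if_splits)
  then have "1 \<le> Suc n \<and> in_leg (Suc n) x"
    by simp
  then have "1 \<le> leg_of x \<and> in_leg (leg_of x) x"
    unfolding leg_of_def by (rule LeastI)
  then show "1 \<le> leg_of x" "in_leg (leg_of x) x"
    by simp_all
qed

lemma not_in_leg_less: "1 \<le> k \<Longrightarrow> k < leg_of x \<Longrightarrow> \<not> in_leg k x"
  using not_less_Least[of k "\<lambda>k. 1 \<le> k \<and> in_leg k x"] by (auto simp: leg_of_def)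

text \<open>If leg \<open>k\<close> misses \<open>x\<close> but leg \<open>k + 1\<close> meets it,
  then \<open>x\<close> lies beyond the start of leg \<open>k\<close>, so
  \<open>\<bar>x\<bar>\<close> exceeds \<open>(2 ^ k - 2) / 3\<close>.\<close>

lemma power_leg_of_le: "2 ^ leg_of x \<le> 6 * \<bar>x\<bar> + 4"
proof (cases "leg_of x = 1")
  case False
  then obtain k where k: "leg_of x = Suc k" "1 \<le> k"
    using leg_of(1)[of x] by (cases "leg_of x") auto
  have "in_leg (Suc k) x" "\<not> in_leg k x"
    using leg_of(2)[of x] not_in_leg_less[of k x] k by simp_all
  then show ?thesis
    unfolding k
    by (cases "even k")
      (auto simp: in_leg_def course_def turning_point_def uminus_power_if abs_if field_simps
        split: if_splits)
qed simp

text \<open>The time at which leg \<open>K\<close> starts, cut off after \<open>n\<close> segments, if the agents are at the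
  beginning of segment \<open>s\<close>.\<close>

primrec leg_start :: "nat \<Rightarrow> nat \<Rightarrow> (agent \<times> nat \<Rightarrow> bool) \<Rightarrow> segment \<Rightarrow> real" where
  "leg_start K 0 \<omega> s = since s"
| "leg_start K (Suc n) \<omega> s =
    (if K \<le> phase s then since s else leg_start K n \<omega> (next_segment \<omega> s))"

definition leg_time :: "nat \<Rightarrow> (agent \<times> nat \<Rightarrow> bool) \<Rightarrow> ennreal" where
  "leg_time K \<omega> = (SUP n. ennreal (leg_start K n \<omega> first_segment))"

lemma leg_start_segment_at:
  assumes "\<And>i. b \<le> i \<Longrightarrow> i < b + n \<Longrightarrow> phase (segment_at \<omega> i) < K"
  shows "leg_start K (n + m) \<omega> (segment_at \<omega> b) = leg_start K m \<omega> (segment_at \<omega> (b + n))"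
  using assms
proof (induction n arbitrary: b)
  case (Suc n)
  have "phase (segment_at \<omega> b) < K"
    using Suc.prems by simp
  moreover have "leg_start K (n + m) \<omega> (segment_at \<omega> (Suc b)) = leg_start K m \<omega> (segment_at \<omega> (Suc b + n))"
    using Suc.prems by (intro Suc.IH) simp
  ultimately show ?case
    by simp
qed simp

lemma leg_start_mono: "leg_start K n \<omega> s \<le> leg_start K (Suc n) \<omega> s"
  by (induction n arbitrary: s) (simp_all add: less_imp_le[OF since_less_expiry])

lemma incseq_leg_start: "incseq (\<lambda>n. leg_start K n \<omega> s)"
  by (intro incseq_SucI leg_start_mono)

lemma leg_time_reached:
  assumes "K \<le> phase (segment_at \<omega> b)" and "\<And>b'. b' < b \<Longrightarrow> phase (segment_at \<omega> b') < K"
  shows "leg_time K \<omega> = ennreal (since (segment_at \<omega> b))"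
proof -
  have eq: "leg_start K (b + m) \<omega> first_segment = since (segment_at \<omega> b)" for m
    using leg_start_segment_at[of 0 b \<omega> K m] assms by (cases m) simp_all
  have "leg_start K n \<omega> first_segment \<le> since (segment_at \<omega> b)" for n
    using incseqD[OF incseq_leg_start, of n "b + n" K \<omega> first_segment] eq[of n] by simp
  then show ?thesis
    unfolding leg_time_def using eq[of 0]
    by (intro antisym SUP_least SUP_upper2[of b]) (auto intro: ennreal_leI)
qed

text \<open>Every segment lasts at least 1, so the cut-off times are unbounded.\<close>

lemma leg_time_not_reached:
  assumes "\<And>b. phase (segment_at \<omega> b) < K"
  shows "leg_time K \<omega> = \<infinity>"
proof -
  have "leg_start K n \<omega> first_segment = since (segment_at \<omega> n)" for n
    using leg_start_segment_at[of 0 n \<omega> K 0] assms by simp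
  then have "of_nat n \<le> leg_time K \<omega>" for n
    unfolding leg_time_def ennreal_of_nat_eq_real_of_nat
    by (intro SUP_upper2[of n]) (simp_all add: since_segment_at_ge ennreal_leI)
  then show ?thesis
    by (metis ennreal_Ex_less_of_nat infinity_ennreal_def leD top.not_eq_extremum)
qed

lemma leg_time_ge: 
  assumes "1 \<le> K"
  shows "ennreal (2 ^ K - 2) \<le> leg_time K \<omega>"
proof (cases "\<exists>b. K \<le> phase (segment_at \<omega> b)")
  case True
  then obtain b where b: "K \<le> phase (segment_at \<omega> b)" "\<And>b'. b' < b \<Longrightarrow> phase (segment_at \<omega> b') < K"
    using exists_least_iff[of "\<lambda>b. K \<le> phase (segment_at \<omega> b)"] by (auto simp: not_le)
  then have "phase (segment_at \<omega> b) = K" "stage (segment_at \<omega> b) = 0"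
    using first_segment_of_phase[of K \<omega> b] assms by blast+
  then show ?thesis
    using since_segment_at_ge_power[of \<omega> b] leg_time_reached[of K \<omega> b] b by (auto intro: ennreal_leI)
next
  case False
  then show ?thesis
    by (simp add: leg_time_not_reached not_le)
qed

text \<open>\<open>Agent1\<close> may overshoot the end of a leg, but \<open>Agent2\<close> never
  does; so it cannot visit a target before the first leg containing it.\<close>

lemma Agent2_in_leg:
  assumes c: "in_segment s c"
  shows "in_leg (phase s) (pos (ag c Agent2))"
  using c by (auto simp: in_segment_def place_def drift_def in_leg_def turning_point_Suc expiry_def
      duration.simps)

text \<open>An equation, because the arrival of \<open>Agent2\<close> decides: \<open>Agent1\<close>
  may see the target earlier while overshooting, and otherwise both reach it together.\<close>

lemma search_time_zigzag:
  "search_time M zigzag x \<omega> = leg_time (leg_of x) \<omega> + ennreal \<bar>x - turning_point (leg_of x)\<bar>"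
proof -
  define K where "K = leg_of x"
  define l where "l = sign (course K) * (x - turning_point K)"
  have l: "0 \<le> l" "l \<le> 2 ^ K" "\<bar>x - turning_point (leg_of x)\<bar> = l"
    and x: "x = turning_point K + sign (course K) * l"
    using leg_of(2)[of x] abs_sign_mult[of "course K" "x - turning_point K"]
    by (simp_all add: l_def in_leg_def K_def del: abs_sign_mult)
  have phase_ge: "K \<le> phase (segment_at \<omega> b)"
    if "in_segment (segment_at \<omega> b) (run M x zigzag \<omega> n)" "pos (ag (run M x zigzag \<omega> n) Agent2) = x"
    for b n
  proof -
    have "1 \<le> phase (segment_at \<omega> b)"
      using phase_segment_at_mono[of 0 b \<omega>] by (simp add: first_segment_def)
    then show ?thesis
      using Agent2_in_leg[OF that(1)] that(2) not_in_leg_less[of "phase (segment_at \<omega> b)" x]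
      unfolding K_def by (metis leI)
  qed
  show ?thesis
  proof (cases "\<exists>b. K \<le> phase (segment_at \<omega> b)")
    case False
    then have "{n. pos (ag (run M x zigzag \<omega> n) Agent2) = x} = {}"
      using run_in_some_segment phase_ge by blast
    then have "arrival_time M zigzag x \<omega> Agent2 = \<infinity>"
      by (simp add: arrival_time_def)
    then show ?thesis
      using False leg_time_not_reached[of \<omega> K] by (simp add: search_time_def K_def not_le)
  next
    case True
    then obtain b where b: "K \<le> phase (segment_at \<omega> b)"
        "\<And>b'. b' < b \<Longrightarrow> phase (segment_at \<omega> b') < K"
      using exists_least_iff[of "\<lambda>b. K \<le> phase (segment_at \<omega> b)"] by (auto simp: not_le)
    define s where "s = segment_at \<omega> b"
    have s: "phase s = K" "stage s = 0"
      using first_segment_of_phase[OF leg_of(1)[of x, folded K_def] b] by (simp_all add: s_def)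
    have time: "leg_time K \<omega> = ennreal (since s)"
      using b leg_time_reached[of K \<omega> b] by (simp add: s_def)
    have since: "0 \<le> since s"
      using since_segment_at_ge[of b \<omega>] by (simp add: s_def)
    have expiry: "expiry s = since s + 2 ^ K"
      using s by (simp add: expiry_def duration.simps)
    obtain n where n: "in_segment s (run M x zigzag \<omega> n)" "now (run M x zigzag \<omega> n) = since s"
      using some_event_at_start[of \<omega> b M x] by (auto simp: s_def)
    have outward: "outward s"
      using n s by (simp add: in_segment_def)
    have at_x: "place s i (since s + l) = x" for i
      using s outward x by (cases i) (simp_all add: place_def drift_def)
    have "\<exists>m. now (run M x zigzag \<omega> m) = since s + l
        \<and> (\<forall>i. pos (ag (run M x zigzag \<omega> m) i) = place s i (since s + l))"
    proof -
      \<comment> \<open>Passing the target is itself an event, so no step skips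
        \<open>since s + l\<close>.\<close>
      have "now c + next_delay x c \<le> since s + l" if c: "in_segment s c" "now c < since s + l" for c
      proof -
        have "pos (ag c Agent2) = place s Agent2 (now c)"
          using c by (simp add: in_segment_def)
        then have "since s + l - now c \<in> hits (pos (ag c Agent2) - x) (drift s Agent2)"
          using c(2) s at_x[of Agent2, symmetric]
          by (intro hitsI) (auto simp: place_def drift_def algebra_simps)
        then have "since s + l - now c \<in> trigger_delays x c Agent2"
          by (simp add: trigger_delays_def Let_def velocity_in_segment[OF c(1)])
        then show ?thesis
          using next_delay_le by fastforce
      qed
      then show ?thesis
        using event_at[OF n(1), of "since s + l"] n(2) l expiry by auto
    qed
    then obtain m where m: "now (run M x zigzag \<omega> m) = since s + l"
        "\<And>i. pos (ag (run M x zigzag \<omega> m) i) = x"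
      using at_x by auto
    have "arrival_time M zigzag x \<omega> i \<le> ennreal (since s + l)" for i
      unfolding arrival_time_def using m by (intro INF_lower2[of m]) simp_all
    moreover have "ennreal (since s + l) \<le> arrival_time M zigzag x \<omega> Agent2"
      unfolding arrival_time_def
    proof (intro INF_greatest ennreal_leI)
      fix n assume "n \<in> {n. pos (ag (run M x zigzag \<omega> n) Agent2) = x}"
      then have pos: "pos (ag (run M x zigzag \<omega> n) Agent2) = x"
        by simp
      obtain b' where b': "in_segment (segment_at \<omega> b') (run M x zigzag \<omega> n)"
        using run_in_some_segment by blast
      have "b \<le> b'"
        using phase_ge[OF b' pos] b(2)[of b'] by (cases "b' < b") auto
      \<comment> \<open>In \<open>s\<close> itself, \<open>Agent2\<close> moves at unit speed and is
        at \<open>x\<close> only once; later segments begin after the whole walk.\<close>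
      then consider "b' = b" | "Suc b \<le> b'"
        by linarith
      then show "since s + l \<le> now (run M x zigzag \<omega> n)"
      proof cases
        case 1
        then have "place s Agent2 (now (run M x zigzag \<omega> n)) = place s Agent2 (since s + l)"
          using b' pos at_x by (simp add: in_segment_def s_def)
        then show ?thesis
          using s by (simp add: place_def drift_def)
      next
        case 2
        then have "expiry s \<le> since (segment_at \<omega> b')"
          using since_segment_at_mono[OF 2, of \<omega>] by (simp add: s_def)
        then show ?thesis
          using b' l expiry by (simp add: in_segment_def)
      qed
    qed
    ultimately have "search_time M zigzag x \<omega> = ennreal (since s + l)"
      unfolding search_time_def by (intro antisym) (auto simp: le_max_iff_disj)
    then show ?thesis
      using time l since by (simp add: K_def)
  qed
qed

section \<open>The expected search time\<close>

lemma prob_space_faults: "prob_space (faults p)"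
  unfolding faults_def by (intro prob_space_PiM measure_pmf.prob_space_axioms)

lemma space_faults [simp]: "space (faults p) = UNIV"
  by (simp add: faults_def space_PiM PiE_def)

lemma UNIV_in_sets_faults [simp]: "UNIV \<in> sets (faults p)"
  using sets.top[of "faults p"] by simp

lemma emeasure_faults_UNIV [simp]: "emeasure (faults p) UNIV = 1"
  using prob_space.emeasure_space_1[OF prob_space_faults[of p]] by simp

lemma measurable_fault [measurable]: "(\<lambda>\<omega>. \<omega> k) \<in> measurable (faults p) (count_space UNIV)"
proof -
  have "(\<lambda>\<omega>. \<omega> k) \<in> measurable (faults p) (measure_pmf (bernoulli_pmf p))"
    unfolding faults_def by (rule measurable_component_singleton) simp
  then show ?thesis
    by (simp cong: measurable_cong_sets)
qed

text \<open>The product measure is invariant under replacing coordinate \<open>k\<close> by a fresh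
  independent bit.\<close>

lemma nn_integral_faults_split:
  assumes p: "0 \<le> p" "p \<le> 1" and h [measurable]: "h \<in> borel_measurable (faults p)"
  shows "(\<integral>\<^sup>+ \<omega>. h \<omega> \<partial>faults p) = ennreal p * (\<integral>\<^sup>+ \<omega>. h (\<omega> (k := True)) \<partial>faults p)
    + ennreal (1 - p) * (\<integral>\<^sup>+ \<omega>. h (\<omega> (k := False)) \<partial>faults p)"
proof -
  interpret F: prob_space "faults p"
    by (rule prob_space_faults)
  let ?B = "measure_pmf (bernoulli_pmf p)"
  have upd: "(\<lambda>(b, \<omega>). \<omega> (k := b)) \<in> measurable (?B \<Otimes>\<^sub>M faults p) (faults p)"
    unfolding faults_def using measurable_fun_upd[of UNIV UNIV k "\<lambda>z. snd z" "?B \<Otimes>\<^sub>M (\<Pi>\<^sub>M k\<in>UNIV. ?B)" "\<lambda>_. ?B" fst]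
    by (simp add: case_prod_unfold)
  have "distr (?B \<Otimes>\<^sub>M faults p) (faults p) (\<lambda>(b, \<omega>). \<omega> (k := b)) = faults p"
    using distr_pair_PiM_eq_PiM[of UNIV "\<lambda>_. ?B" k, OF measure_pmf.prob_space_axioms
        measure_pmf.prob_space_axioms]
    by (simp add: faults_def)
  then have "(\<integral>\<^sup>+ \<omega>. h \<omega> \<partial>faults p)
      = (\<integral>\<^sup>+ \<omega>. h \<omega> \<partial>distr (?B \<Otimes>\<^sub>M faults p) (faults p) (\<lambda>(b, \<omega>). \<omega> (k := b)))"
    by simp
  also have "\<dots> = (\<integral>\<^sup>+ z. h ((\<lambda>(b, \<omega>). \<omega> (k := b)) z) \<partial>(?B \<Otimes>\<^sub>M faults p))"
    by (subst nn_integral_distr[OF upd]) (simp_all add: h)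
  also have "\<dots> = (\<integral>\<^sup>+ b. \<integral>\<^sup>+ \<omega>. h (\<omega> (k := b)) \<partial>faults p \<partial>?B)"
    using measurable_compose[OF upd h] by (subst F.nn_integral_fst[symmetric]) simp_all
  finally show ?thesis
    using p by (simp add: mult.commute)
qed

section \<open>Recursion for the expected start of a leg\<close>

definition attempt :: "segment \<Rightarrow> bool \<Rightarrow> segment" where
  "attempt s f = \<lparr>phase = phase s, stage = Suc (stage s), outward = f,
     tries = Suc (tries s), since = expiry s\<rparr>"

lemma next_segment_attempt:
  "stage s \<noteq> 0 \<Longrightarrow> outward s \<Longrightarrow> next_segment \<omega> s = attempt s (\<omega> (Agent1, tries s))"
  by (simp add: next_segment_def attempt_def)

lemma next_segment_deterministic:
  "stage s = 0 \<or> \<not> outward s \<Longrightarrow> next_segment \<omega> s = next_segment \<omega>' s"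
  by (auto simp: next_segment_def)

lemma measurable_leg_start [measurable]: "(\<lambda>\<omega>. leg_start K n \<omega> s) \<in> borel_measurable (faults p)"
proof (induction n arbitrary: s)
  case (Suc n)
  note Suc.IH [measurable]
  show ?case
  proof (cases "stage s = 0 \<or> \<not> outward s")
    case True
    then obtain s' where "\<And>\<omega>. next_segment \<omega> s = s'"
      using next_segment_deterministic by blast
    then show ?thesis
      by (simp cong: if_cong)
  next
    case False
    then have "leg_start K (Suc n) \<omega> s = (if K \<le> phase s then since s
        else if \<omega> (Agent1, tries s) then leg_start K n \<omega> (attempt s True)
        else leg_start K n \<omega> (attempt s False))" for \<omega>
      by (cases "\<omega> (Agent1, tries s)") (simp_all add: next_segment_attempt)
    then show ?thesis
      by simp
  qed
qed simp

text \<open>\<open>tries\<close> never decreases, so an outcome already used is not read again; this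
  replaces an independence argument.\<close>

lemma leg_start_upd:
  assumes "k < tries s"
  shows "leg_start K n (\<omega> ((Agent1, k) := f)) s = leg_start K n \<omega> s"
  using assms
proof (induction n arbitrary: s)
  case (Suc n)
  have "next_segment (\<omega> ((Agent1, k) := f)) s = next_segment \<omega> s" "k < tries (next_segment \<omega> s)"
    using Suc.prems by (auto simp: next_segment_def)
  then show ?case
    by (simp only: leg_start.simps Suc.IH)
qed simp

text \<open>The expected time from the beginning of segment \<open>s\<close> until leg \<open>K\<close> starts.  From an attempt
  of duration \<open>u\<close> on, finishing the turn takes the expected time
  \<open>u + 2 p u + 4 p\<^sup>2 u + \<dots> = u / (1 - 2 p)\<close>.\<close>

definition time_left :: "real \<Rightarrow> nat \<Rightarrow> segment \<Rightarrow> real" where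
  "time_left p K s =
    (let a = 1 / (1 - 2 * p); rest = (\<lambda>k. 2 ^ K - 2 ^ k + (1 + a) * (real K - real k)) in
     if K \<le> phase s then 0
     else if stage s = 0 then rest (phase s)
     else rest (Suc (phase s)) + duration (phase s) (stage s)
       + (if outward s then a * 2 ^ (stage s - 1) else 0))"

lemma time_left_nonneg:
  assumes "p < 1 / 2"
  shows "0 \<le> time_left p K s"
proof -
  have "0 \<le> 2 ^ K - 2 ^ k + (1 + 1 / (1 - 2 * p)) * (real K - real k)" if "k \<le> K" for k
    using assms that by (intro add_nonneg_nonneg mult_nonneg_nonneg) simp_all
  from this[of "phase s"] this[of "Suc (phase s)"] show ?thesis
    using assms order_trans[OF zero_le_one duration_ge_1]
    by (auto simp: time_left_def Let_def intro!: add_nonneg_nonneg)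
qed

text \<open>Each remaining leg is charged its length, one unit for walking ahead and the mean
  \<open>a\<close> of a turn; the lengths telescope to \<open>2 ^ K - 2 ^ k\<close>.\<close>

lemma time_left_deterministic:
  assumes "phase s < K" and "stage s = 0 \<or> \<not> outward s"
  shows "time_left p K s = duration (phase s) (stage s) + time_left p K (next_segment \<omega> s)"
proof (cases "stage s = 0")
  case True
  then show ?thesis
    using assms by (simp add: time_left_def next_segment_def Let_def duration.simps algebra_simps)
next
  case False
  show ?thesis
  proof (cases "K = Suc (phase s)")
    case True
    then show ?thesis
      using False assms by (simp add: time_left_def next_segment_def Let_def)
  next
    case False
    then show ?thesis
      using \<open>stage s \<noteq> 0\<close> assms by (simp add: time_left_def next_segment_def Let_def)
  qed
qed

lemma time_left_attempt:
  assumes "p < 1 / 2" and "phase s < K" and "stage s \<noteq> 0" and "outward s"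
  shows "time_left p K s = duration (phase s) (stage s)
    + (p * time_left p K (attempt s True) + (1 - p) * time_left p K (attempt s False))"
proof -
  define a where "a = 1 / (1 - 2 * p)"
  obtain j where j: "stage s = Suc j"
    using assms(3) not0_implies_Suc by blast
  \<comment> \<open>The mean of a turn: one unit for the first try and, with probability
    \<open>p\<close>, a new turn on twice the scale.\<close>
  have a: "a = 1 + 2 * p * a"
    using assms(1) by (simp add: a_def field_simps)
  have "a * 2 ^ j = 2 ^ j + 2 * p * a * 2 ^ j"
    using arg_cong[OF a, of "\<lambda>u. u * 2 ^ j"] by (simp add: algebra_simps)
  then show ?thesis
    using assms unfolding time_left_def Let_def a_def[symmetric]
    by (simp add: attempt_def j duration.simps algebra_simps)
qed

text \<open>Before leg \<open>K\<close>, a segment preserves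
  \<open>since s + time_left p K s\<close> in the mean, and this quantity bounds the cut-off value
  \<open>since s\<close>.\<close>

lemma nn_integral_leg_start_le:
  assumes p: "0 \<le> p" "p < 1 / 2" and "0 \<le> since s"
  shows "(\<integral>\<^sup>+ \<omega>. ennreal (leg_start K n \<omega> s) \<partial>faults p) \<le> ennreal (since s + time_left p K s)"
  using assms(3)
proof (induction n arbitrary: s)
  case 0
  then show ?case
    using time_left_nonneg[OF p(2), of K s]
    by (simp add: ennreal_leI)
next
  case (Suc n)
  have expiry: "0 \<le> expiry s" "expiry s = since s + duration (phase s) (stage s)"
    using Suc.prems since_less_expiry[of s] by (simp_all add: expiry_def)
  consider "K \<le> phase s" | "phase s < K" "stage s = 0 \<or> \<not> outward s"
    | "phase s < K" "stage s \<noteq> 0" "outward s"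
    by linarith
  then show ?case
  proof cases
    case 1
    then show ?thesis
      using Suc.prems time_left_nonneg[OF p(2), of K s]
      by (simp add: ennreal_leI)
  next
    case 2
    obtain s' where s': "\<And>\<omega>. next_segment \<omega> s = s'"
      using next_segment_deterministic[OF 2(2)] by blast
    have since: "since s' = expiry s"
      using since_next_segment s' by metis
    have "since s' + time_left p K s' = since s + time_left p K s"
      using time_left_deterministic[OF 2, of p undefined] expiry by (simp add: s' since)
    moreover have "0 \<le> since s'"
      using expiry by (simp add: since)
    ultimately show ?thesis
      using Suc.IH[of s'] 2(1) by (simp add: s')
  next
    case 3
    have "(\<integral>\<^sup>+ \<omega>. ennreal (leg_start K (Suc n) \<omega> s) \<partial>faults p)
        = (\<integral>\<^sup>+ \<omega>. ennreal (leg_start K n \<omega> (next_segment \<omega> s)) \<partial>faults p)"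
      using 3(1) by simp
    also have "\<dots> = ennreal p * (\<integral>\<^sup>+ \<omega>. ennreal (leg_start K n \<omega> (attempt s True)) \<partial>faults p)
        + ennreal (1 - p) * (\<integral>\<^sup>+ \<omega>. ennreal (leg_start K n \<omega> (attempt s False)) \<partial>faults p)"
    proof -
      have "(\<lambda>\<omega>. leg_start K (Suc n) \<omega> s) \<in> borel_measurable (faults p)"
        by (rule measurable_leg_start)
      then have "(\<lambda>\<omega>. leg_start K n \<omega> (next_segment \<omega> s)) \<in> borel_measurable (faults p)"
        using 3(1) by simp
      then have "(\<lambda>\<omega>. ennreal (leg_start K n \<omega> (next_segment \<omega> s))) \<in> borel_measurable (faults p)"
        by measurable
      moreover have "leg_start K n (\<omega> ((Agent1, tries s) := f)) (attempt s f) = leg_start K n \<omega> (attempt s f)"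
        for \<omega> f
        by (rule leg_start_upd) (simp add: attempt_def)
      ultimately show ?thesis
        using p 3 by (subst nn_integral_faults_split[where k = "(Agent1, tries s)"])
          (simp_all add: next_segment_attempt)
    qed
    also have "\<dots> \<le> ennreal p * ennreal (expiry s + time_left p K (attempt s True))
        + ennreal (1 - p) * ennreal (expiry s + time_left p K (attempt s False))"
      using Suc.IH[of "attempt s True"] Suc.IH[of "attempt s False"] expiry(1)
      by (intro add_mono mult_left_mono) (simp_all add: attempt_def)
    also have "\<dots> = ennreal (p * (expiry s + time_left p K (attempt s True))
        + (1 - p) * (expiry s + time_left p K (attempt s False)))"
      using p expiry(1) time_left_nonneg[OF p(2)]
      by (simp add: ennreal_mult)
    also have "\<dots> = ennreal (since s + time_left p K s)"
      unfolding time_left_attempt[OF p(2) 3] expiry(2) by (simp add: algebra_simps)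
    finally show ?thesis .
  qed
qed


lemma measurable_leg_time [measurable]: "leg_time K \<in> borel_measurable (faults p)"
  unfolding leg_time_def by measurable

text \<open>The bound is uniform in the cut-off, so monotone convergence transfers it without
  knowing beforehand that leg \<open>K\<close> is almost surely reached.\<close>

lemma nn_integral_leg_time_le:
  assumes "0 \<le> p" "p < 1 / 2" and "1 \<le> K"
  shows "(\<integral>\<^sup>+ \<omega>. leg_time K \<omega> \<partial>faults p)
    \<le> ennreal (2 ^ K - 2 + (1 + 1 / (1 - 2 * p)) * (real K - 1))"
proof -
  have "(\<integral>\<^sup>+ \<omega>. leg_time K \<omega> \<partial>faults p)
      = (SUP n. \<integral>\<^sup>+ \<omega>. ennreal (leg_start K n \<omega> first_segment) \<partial>faults p)"
    unfolding leg_time_def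
    by (intro nn_integral_monotone_convergence_SUP)
      (auto simp: incseq_def le_fun_def intro!: ennreal_leI incseqD[OF incseq_leg_start])
  also have "\<dots> \<le> ennreal (since first_segment + time_left p K first_segment)"
    using assms by (intro SUP_least nn_integral_leg_start_le) (simp_all add: first_segment_def)
  also have "since first_segment + time_left p K first_segment
      = 2 ^ K - 2 + (1 + 1 / (1 - 2 * p)) * (real K - 1)"
    using assms(3) by (auto simp: first_segment_def time_left_def Let_def)
  finally show ?thesis .
qed


section \<open>Performance\<close>

text \<open>The time of an ideal zigzag with instantaneous turns; even a turn that succeeds at once
  counts as delay.\<close>

definition faultless_time :: "real \<Rightarrow> real" where
  "faultless_time x = 2 ^ leg_of x - 2 + \<bar>x - turning_point (leg_of x)\<bar>"

definition delay_bound :: "real \<Rightarrow> real \<Rightarrow> real" where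
  "delay_bound p x = (1 + 1 / (1 - 2 * p)) * (real (leg_of x) - 1)"

lemma power_leg_of_ge: "2 \<le> (2::real) ^ leg_of x"
  using power_increasing[OF leg_of(1)[of x], of "2::real"] by simp

lemma faultless_time_nonneg: "0 \<le> faultless_time x"
  using power_leg_of_ge[of x] by (simp add: faultless_time_def)

text \<open>For \<open>K = leg_of x\<close> the time is at most
  \<open>4 / 3 * (2 ^ K - 1) + \<bar>x\<bar>\<close>, and inserting \<open>power_leg_of_le\<close>
  gives \<open>9 * \<bar>x\<bar> + 4\<close>.\<close>

lemma faultless_time_le: "faultless_time x \<le> 9 * \<bar>x\<bar> + 7"
proof -
  have "\<bar>turning_point (leg_of x)\<bar> \<le> (2 ^ leg_of x + 2) / 3"
    by (simp add: turning_point_def abs_le_iff uminus_power_if)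
  then show ?thesis
    using power_leg_of_le[of x] by (simp add: faultless_time_def)
qed

lemma faultless_time_le_search_time: "ennreal (faultless_time x) \<le> search_time M zigzag x \<omega>"
  using leg_time_ge[OF leg_of(1), of x \<omega>] power_leg_of_ge[of x]
  by (simp add: search_time_zigzag faultless_time_def add_right_mono)

lemma measurable_search_time [measurable]: "search_time M zigzag x \<in> borel_measurable (faults p)"
proof -
  have "search_time M zigzag x
      = (\<lambda>\<omega>. leg_time (leg_of x) \<omega> + ennreal \<bar>x - turning_point (leg_of x)\<bar>)"
    by (intro ext search_time_zigzag)
  then show ?thesis
    by simp
qed

lemma delay_bound_nonneg: "p < 1 / 2 \<Longrightarrow> 0 \<le> delay_bound p x"
  using leg_of(1)[of x] by (auto simp: delay_bound_def intro!: mult_nonneg_nonneg add_nonneg_nonneg)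

lemma expected_time_le:
  assumes "0 \<le> p" "p < 1 / 2"
  shows "expected_time p M zigzag x \<le> ennreal (faultless_time x + delay_bound p x)"
proof -
  have "expected_time p M zigzag x = (\<integral>\<^sup>+ \<omega>. leg_time (leg_of x) \<omega> \<partial>faults p)
      + ennreal \<bar>x - turning_point (leg_of x)\<bar>"
    by (simp add: expected_time_def search_time_zigzag nn_integral_add)
  also have "\<dots> \<le> ennreal (2 ^ leg_of x - 2 + delay_bound p x)
      + ennreal \<bar>x - turning_point (leg_of x)\<bar>"
    using nn_integral_leg_time_le[OF assms leg_of(1), of x]
    by (intro add_right_mono) (simp add: delay_bound_def)
  also have "\<dots> = ennreal (faultless_time x + delay_bound p x)"
    using delay_bound_nonneg[OF assms(2), of x] power_leg_of_ge[of x]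
    by (subst ennreal_plus[symmetric]) (simp_all add: faultless_time_def algebra_simps)
  finally show ?thesis .
qed

lemma eventually_delay_bound_le:
  assumes "p < 1 / 2" and "0 < \<delta>"
  shows "\<forall>\<^sub>F x in at_infinity. delay_bound p x \<le> \<delta> * \<bar>x\<bar>"
proof -
  define a where "a = 1 + 1 / (1 - 2 * p)"
  have a: "0 < a"
    using assms by (simp add: a_def add_pos_pos)
  have "\<forall>\<^sub>F r :: real in at_top. a * log 2 (6 * r + 4) \<le> \<delta> * r"
    using a assms(2) by real_asymp
  then have "\<forall>\<^sub>F x :: real in at_infinity. a * log 2 (6 * \<bar>x\<bar> + 4) \<le> \<delta> * \<bar>x\<bar>"
    using filterlim_norm_at_top[where 'a = real] by (auto simp: filterlim_iff)
  then show ?thesis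
  proof eventually_elim
    case (elim x)
    have "real (leg_of x) \<le> log 2 (6 * \<bar>x\<bar> + 4)"
      using power_leg_of_le[of x] by (subst le_log_iff) (auto simp: powr_realpow)
    then have "a * (real (leg_of x) - 1) \<le> a * log 2 (6 * \<bar>x\<bar> + 4)"
      using a by (intro mult_left_mono) simp_all
    with elim show ?case
      by (simp add: delay_bound_def a_def)
  qed
qed

lemma eventually_le_abs: "\<forall>\<^sub>F x :: real in at_infinity. c \<le> \<bar>x\<bar>"
  using eventually_at_infinity by fastforce

text \<open>A finite expectation forces almost sure finiteness.\<close>

lemma solves_PDLS_zigzag:
  assumes "0 \<le> p" "p < 1 / 2"
  shows "solves_PDLS p M zigzag"
  unfolding solves_PDLS_def
proof (intro allI conjI)
  fix x
  have "(\<integral>\<^sup>+ \<omega>. search_time M zigzag x \<omega> \<partial>faults p) \<noteq> \<infinity>"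
    using expected_time_le[OF assms, of M x] by (auto simp: expected_time_def top_unique)
  then show "AE \<omega> in faults p. search_time M zigzag x \<omega> < \<infinity>"
    using nn_integral_PInf_AE[OF measurable_search_time] by (simp add: less_top)
qed (rule measurable_search_time)

lemma competitive_ratio_zigzag_le:
  assumes "0 \<le> p" "p < 1 / 2" "0 < \<epsilon>"
  shows "competitive_ratio p M zigzag \<le> ennreal (9 + \<epsilon>)"
  unfolding competitive_ratio_def
proof (rule Limsup_bounded)
  have "\<forall>\<^sub>F x in at_infinity. delay_bound p x \<le> \<epsilon> / 2 * \<bar>x\<bar>"
    using assms by (intro eventually_delay_bound_le) simp_all
  \<comment> \<open>Half of \<open>\<epsilon>\<close> absorbs the constant 7, the other half the
    delay; the bound 1 keeps the divisor nonzero.\<close>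
  with eventually_le_abs[of "14 / \<epsilon>"] eventually_le_abs[of 1]
  show "\<forall>\<^sub>F x in at_infinity. expected_time p M zigzag x / ennreal \<bar>x\<bar> \<le> ennreal (9 + \<epsilon>)"
  proof eventually_elim
    case (elim x)
    have "7 \<le> \<epsilon> / 2 * \<bar>x\<bar>"
      using elim(1) assms(3) by (simp add: field_simps)
    then have "faultless_time x + delay_bound p x \<le> (9 + \<epsilon>) * \<bar>x\<bar>"
      using faultless_time_le[of x] elim(3) by (simp add: algebra_simps)
    then have "expected_time p M zigzag x \<le> ennreal ((9 + \<epsilon>) * \<bar>x\<bar>)"
      using expected_time_le[OF assms(1,2), of M x] by (meson ennreal_leI order_trans)
    then have "expected_time p M zigzag x / ennreal \<bar>x\<bar> \<le> ennreal ((9 + \<epsilon>) * \<bar>x\<bar>) / ennreal \<bar>x\<bar>"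
      by (rule divide_right_mono_ennreal)
    also have "\<dots> = ennreal (9 + \<epsilon>)"
      using elim(2) assms(3) by (subst divide_ennreal) auto
    finally show ?case .
  qed
qed

text \<open>The search time exceeds \<open>faultless_time x\<close> by a nonnegative delay whose expectation is
  only logarithmic in \<open>\<bar>x\<bar>\<close>, so that Markov's inequality suffices, and no second moment, which is
  infinite for \<open>p \<ge> 1/4\<close>, is needed.\<close>

lemma performance_concentrated_zigzag:
  assumes p: "0 \<le> p" "p < 1 / 2" and "0 < \<epsilon>"
  shows "performance_concentrated p M zigzag (9 + \<epsilon>)"
  unfolding performance_concentrated_def
proof (intro allI impI)
  fix \<delta> \<eta> :: real assume "0 < \<delta>" "0 < \<eta>"
  interpret F: prob_space "faults p"
    by (rule prob_space_faults)
  \<comment> \<open>With the factor \<open>\<delta> * \<eta>\<close>, Markov's inequality at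
    threshold \<open>\<delta> * \<bar>x\<bar>\<close> leaves probability at most
    \<open>\<eta>\<close>.\<close>
  have "\<forall>\<^sub>F x in at_infinity. delay_bound p x \<le> \<delta> * \<bar>x\<bar>"
      "\<forall>\<^sub>F x in at_infinity. delay_bound p x \<le> (\<delta> * \<eta>) * \<bar>x\<bar>"
    using p \<open>0 < \<delta>\<close> \<open>0 < \<eta>\<close> by (intro eventually_delay_bound_le; simp)+
  with eventually_le_abs[of 1] eventually_le_abs[of "7 / \<epsilon>"]
  show "\<forall>\<^sub>F x in at_infinity. 1 - \<eta> \<le> measure (faults p) {\<omega> \<in> space (faults p).
      search_time M zigzag x \<omega> \<le> ennreal ((9 + \<epsilon> + \<delta>) * \<bar>x\<bar>) \<and>
      search_time M zigzag x \<omega> \<le> expected_time p M zigzag x + ennreal (\<delta> * \<bar>x\<bar>) \<and>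
      expected_time p M zigzag x \<le> search_time M zigzag x \<omega> + ennreal (\<delta> * \<bar>x\<bar>)}"
    (is "\<forall>\<^sub>F x in _. 1 - \<eta> \<le> measure _ (?good x)")
  proof eventually_elim
    case (elim x)
    let ?S = "search_time M zigzag x" and ?E = "expected_time p M zigzag x"
    let ?D = "faultless_time x" and ?d = "\<delta> * \<bar>x\<bar>"
    have d: "0 < ?d"
      using elim(1) \<open>0 < \<delta>\<close> by (simp add: zero_less_mult_iff)
    have D_le_E: "ennreal ?D \<le> ?E"
    proof -
      have "(\<integral>\<^sup>+ \<omega>. ennreal ?D \<partial>faults p) \<le> ?E"
        unfolding expected_time_def
        by (intro nn_integral_mono faultless_time_le_search_time)
      then show ?thesis
        by simp
    qed
    have E_le: "?E \<le> ennreal ?D + ennreal ?d"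
    proof -
      have "?E \<le> ennreal (?D + delay_bound p x)"
        by (rule expected_time_le[OF p])
      also have "\<dots> \<le> ennreal (?D + ?d)"
        using elim(3) by (intro ennreal_leI) simp
      finally show ?thesis
        using d faultless_time_nonneg[of x] by simp
    qed
    \<comment> \<open>Only upward deviations need a probability bound: no search time is below
      \<open>?D\<close>, and \<open>?E\<close> exceeds \<open>?D\<close> by at most
      \<open>?d\<close>.\<close>
    have good: "\<omega> \<in> ?good x" if "?S \<omega> - ennreal ?D < ennreal ?d" for \<omega>
    proof -
      have "?S \<omega> = ennreal ?D + (?S \<omega> - ennreal ?D)"
        using faultless_time_le_search_time[of x M \<omega>] by (simp add: add_diff_inverse_ennreal)
      also have "\<dots> \<le> ennreal ?D + ennreal ?d"
        using that by (intro add_left_mono) simp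
      finally have S_le: "?S \<omega> \<le> ennreal ?D + ennreal ?d" .
      have "7 \<le> \<epsilon> * \<bar>x\<bar>"
        using elim(2) \<open>0 < \<epsilon>\<close> by (simp add: field_simps)
      then have "?D + ?d \<le> (9 + \<epsilon> + \<delta>) * \<bar>x\<bar>"
        using faultless_time_le[of x] by (simp add: algebra_simps)
      then have "?S \<omega> \<le> ennreal ((9 + \<epsilon> + \<delta>) * \<bar>x\<bar>)"
        using S_le d faultless_time_nonneg[of x] ennreal_leI order_trans
        by (metis ennreal_plus less_imp_le)
      moreover have "?S \<omega> \<le> ?E + ennreal ?d"
        using S_le D_le_E by (meson add_right_mono order_trans)
      moreover have "?E \<le> ?S \<omega> + ennreal ?d"
        using E_le faultless_time_le_search_time[of x M \<omega>] by (meson add_right_mono order_trans)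
      ultimately show ?thesis
        by simp
    qed
    let ?bad = "{\<omega> \<in> space (faults p). 1 \<le> ennreal (1 / ?d) * (?S \<omega> - ennreal ?D)}"
    have "emeasure (faults p) ?bad
        \<le> ennreal (1 / ?d) * (\<integral>\<^sup>+ \<omega>. (?S \<omega> - ennreal ?D) * indicator (space (faults p)) \<omega> \<partial>faults p)"
      by (intro nn_integral_Markov_inequality) simp_all
    also have "\<dots> \<le> ennreal (1 / ?d) * ennreal (delay_bound p x)"
    proof (intro mult_left_mono)
      have "(\<integral>\<^sup>+ \<omega>. (?S \<omega> - ennreal ?D) * indicator (space (faults p)) \<omega> \<partial>faults p) = ?E - ennreal ?D"
        using faultless_time_le_search_time by (simp add: nn_integral_diff expected_time_def)
      also have "\<dots> \<le> ennreal (?D + delay_bound p x) - ennreal ?D"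
        by (intro ennreal_minus_mono expected_time_le[OF p]) simp
      also have "\<dots> = ennreal (delay_bound p x)"
        using faultless_time_nonneg[of x] by (simp add: ennreal_minus)
      finally show "(\<integral>\<^sup>+ \<omega>. (?S \<omega> - ennreal ?D) * indicator (space (faults p)) \<omega> \<partial>faults p)
          \<le> ennreal (delay_bound p x)" .
    qed simp
    also have "\<dots> = ennreal (delay_bound p x / ?d)"
      using d delay_bound_nonneg[OF p(2), of x] by (simp flip: ennreal_mult)
    also have "\<dots> \<le> ennreal \<eta>"
      using elim(4) d by (intro ennreal_leI) (simp add: divide_le_eq algebra_simps)
    finally have "measure (faults p) ?bad \<le> \<eta>"
      using \<open>0 < \<eta>\<close> by (simp add: F.emeasure_eq_measure)
    moreover have "?bad \<in> sets (faults p)"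
      by measurable
    ultimately have "1 - \<eta> \<le> measure (faults p) (space (faults p) - ?bad)"
      using F.prob_compl[of ?bad] by linarith
    also have "\<dots> \<le> measure (faults p) (?good x)"
    proof (intro F.finite_measure_mono subsetI)
      fix \<omega> assume "\<omega> \<in> space (faults p) - ?bad"
      then have less: "ennreal (1 / ?d) * (?S \<omega> - ennreal ?D) < 1"
        by (simp add: not_le)
      have "?S \<omega> - ennreal ?D < ennreal ?d"
      proof (rule ccontr)
        assume "\<not> ?S \<omega> - ennreal ?D < ennreal ?d"
        then have "ennreal (1 / ?d) * ennreal ?d \<le> ennreal (1 / ?d) * (?S \<omega> - ennreal ?D)"
          by (intro mult_left_mono) simp_all
        moreover have "ennreal (1 / ?d) * ennreal ?d = 1"
          using d by (auto simp flip: ennreal_mult)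
        ultimately show False
          using less by simp
      qed
      then show "\<omega> \<in> ?good x"
        by (rule good)
    qed measurable
    finally show ?case .
  qed
qed

text \<open>The witness \<open>zigzag\<close> is the same for all \<open>p\<close>, all
  \<open>\<epsilon>\<close> and both communication models.\<close>

theorem theorem4:
  fixes p \<epsilon> :: real
  assumes "0 \<le> p" and "p < 1 / 2" and "0 < \<epsilon>"
  shows "\<exists>P. admissible P \<and>
    (\<forall>M. solves_PDLS p M P
       \<and> competitive_ratio p M P \<le> ennreal (9 + \<epsilon>)
       \<and> performance_concentrated p M P (9 + \<epsilon>))"
  using admissible_zigzag solves_PDLS_zigzag competitive_ratio_zigzag_le
    performance_concentrated_zigzag assms by blast

end
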